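(* Let $\gamma,\theta\in(0,1)$, let $y_k\in\mathcal Y_{\mathrm{adm}}$, $b:=\nabla\operatorname{tr}F(y_k)\in\mathbb R^m$, and let $\overline z\in\mathbb R$ be an upper bound of the optimal linearized value, i.e. $\overline z\ge\max_{w\in\mathcal Y_{\mathrm{adm}}}b^Tw$. (i) For all $y_{k+1}\in\mathcal Y_{\mathrm{adm}}$, $$r(y_{k+1})\le r(y_k)-b^T(y_{k+1}-y_k).$$ (ii) If $y_k$ satisfies $$r(y_k)<(1-\gamma)\frac{y_{\min}^2}{L^2\operatorname{tr}\hat Y},$$ then $$\overline z-b^Ty_k\ge\gamma\, r(y_k).$$ (iii) If $y_k$ satisfies the condition in (ii) and, additionally, $y_{k+1}\in\mathcal Y_{\mathrm{adm}}$ satisfies $$b^T(y_{k+1}-y_k)\ge\theta(\overline z-b^Ty_k),$$ then, with $\mu_k:=1-\frac{L^2}{y_{\min}^2}r(y_k)\operatorname{tr}\hat Y$, $$r(y_{k+1})\le(1-\theta\mu_k)r(y_k)\le(1-\theta\gamma)r(y_k).$$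
   Context: Let $l,n,m\in\mathbb N$. $\mathbb S^k$, $\mathbb S^k_+$, $\mathbb S^k_{++}$ denote the real symmetric, positive semidefinite, positive definite $k\times k$ matrices; $\succeq$ is the Loewner order; $\|\cdot\|_2$ is the spectral norm for matrices. Inequalities between vectors are componentwise, $[y^-,y^+]=\{y\in\mathbb R^m: y^-\le y\le y^+\}$, $\mathbf 1$ is the all-ones vector, $\mathbb R^m_{++}=(0,\infty)^m$. Let $0\ne A_i\in\mathbb S^n_+$ ($i=1,\dots,m$), $A_y:=\sum_{j=1}^m y_jA_j$ for $y\in\mathbb R^m$, assume $A_{\mathbf 1}\succ0$, and let $B\in\mathbb R^{l\times n}$ have full row rank. Define $F:\mathbb R^m_{++}\to\mathbb S^l$, $F(y)=BA_y^{-1}B^T$. Let $y^\pm\in\mathbb R^m$ with $y^+>y^->0$, $\delta>0$, $\hat y\in[y^-+\delta\mathbf 1,y^+-\delta\mathbf 1]$, and $\hat Y:=F(\hat y)\in\mathbb S^l_{++}$. Assume there is $L>0$ with $\|y-z\|_\infty\le L\|F(y)-F(z)\|_2$ for all $y,z\in[y^-,y^+]$. Let $\mathcal Y_{\mathrm{adm}}:=\{y\in[y^-,y^+]: F(y)\preceq\hat Y\}$ (equivalently $\{y\in[y^-,y^+]:A_y\succeq C\}$ with $C:=B^T\hat Y^{-1}B$), $r(y):=\operatorname{tr}(\hat Y-F(y))$, $y_{\min}:=\min_i y^-_i$. $\nabla\operatorname{tr}F(y)\in\mathbb R^m$ has entries $-\operatorname{tr}(BA_y^{-1}A_iA_y^{-1}B^T)$.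 *)

theory Defs
  imports "HOL-Analysis.Analysis"
begin

definition psd :: "real^'k^'k \<Rightarrow> bool" where
  "psd M \<longleftrightarrow> transpose M = M \<and> (\<forall>x. 0 \<le> x \<bullet> (M *v x))"

definition pd :: "real^'k^'k \<Rightarrow> bool" where
  "pd M \<longleftrightarrow> transpose M = M \<and> (\<forall>x. x \<noteq> 0 \<longrightarrow> 0 < x \<bullet> (M *v x))"

definition loewner_le :: "real^'k^'k \<Rightarrow> real^'k^'k \<Rightarrow> bool" (infix \<open>\<preceq>\<^sub>L\<close> 50) where
  "M \<preceq>\<^sub>L N \<longleftrightarrow> psd (N - M)"

definition spectral_norm :: "real^'a^'b \<Rightarrow> real" where
  "spectral_norm M = onorm ((*v) M)"

text \<open>The Euclidean gradient; it is the true gradient wherever \<open>f\<close> is differentiable,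
  and unspecified elsewhere.\<close>

definition grad :: "('a::real_inner \<Rightarrow> real) \<Rightarrow> 'a \<Rightarrow> 'a" where
  "grad f x = (THE D. GDERIV f x :> D)"

definition mat_comb :: "('m::finite \<Rightarrow> real^'n^'n) \<Rightarrow> real^'m \<Rightarrow> real^'n^'n" where
  "mat_comb A y = (\<Sum>j\<in>UNIV. (y $ j) *\<^sub>R A j)"

text \<open>Only the values of \<open>F_map A B\<close> at componentwise positive \<open>y\<close> are meaningful: there
  \<open>mat_comb A y\<close> is positive definite as soon as every \<open>A j\<close> is positive semidefinite and
  \<open>mat_comb A 1\<close> is positive definite. Here \<open>1\<close> is the all-ones vector.\<close>

definition F_map :: "('m::finite \<Rightarrow> real^'n^'n) \<Rightarrow> real^'n^'l \<Rightarrow> real^'m \<Rightarrow> real^'l^'l" where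
  "F_map A B y = B ** matrix_inv (mat_comb A y) ** transpose B"

text \<open>The order on \<open>real^'m\<close> is componentwise, so \<open>{ym..yp}\<close> is a box.\<close>

definition Y_adm ::
  "('m::finite \<Rightarrow> real^'n^'n) \<Rightarrow> real^'n^'l \<Rightarrow> real^'m \<Rightarrow> real^'m \<Rightarrow> real^'l^'l \<Rightarrow> (real^'m) set"
where
  "Y_adm A B ym yp Yhat = {y \<in> {ym..yp}. F_map A B y \<preceq>\<^sub>L Yhat}"

definition resid ::
  "('m::finite \<Rightarrow> real^'n^'n) \<Rightarrow> real^'n^'l \<Rightarrow> real^'l^'l \<Rightarrow> real^'m \<Rightarrow> real" where
  "resid A B Yhat y = trace (Yhat - F_map A B y)"

end

(* With E = A_z - A_y, the linearisation error of the inverse is exactly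
   A_z^{-1} - A_y^{-1} + A_y^{-1} E A_y^{-1} = A_y^{-1} E A_z^{-1} E A_y^{-1}.
   It is positive semidefinite, and if A_y, A_z >= c A_1 and -eps A_1 <= E <= eps A_1, then it is at
   most (eps/c)^2 A_y^{-1}. Hence tr F is convex, its gradient exists, and the linearisation error of
   tr F is at most (eps/c)^2 tr F(y). For y = y_k and z = yhat, the stability assumption allows
   eps = L r(y_k) because ||Yhat - F(y_k)||_2 <= tr(Yhat - F(y_k)); this gives
   b^T (yhat - y_k) >= mu_k r(y_k). *)

theory Submission
  imports Defs
begin

section \<open>Sums and traces of matrices, positive semidefinite matrices and the gradient\<close>

lemma sum_matrix_vector_mult:
  fixes M :: "'i \<Rightarrow> real^'n^'m"
  shows "(\<Sum>j\<in>S. M j) *v x = (\<Sum>j\<in>S. M j *v x)"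
  by (induction S rule: infinite_finite_induct) (auto simp: matrix_vector_mult_add_rdistrib)

lemma inner_mat_comb_mult:
  "x \<bullet> (mat_comb A y *v z) = (\<Sum>j\<in>UNIV. y $ j * (x \<bullet> (A j *v z)))"
  by (simp add: mat_comb_def sum_matrix_vector_mult inner_sum_right
      scaleR_matrix_vector_assoc [symmetric])

lemma mat_comb_diff: "mat_comb A (z - y) = mat_comb A z - mat_comb A y"
  by (simp add: mat_comb_def scaleR_left_diff_distrib sum_subtractf)

text \<open>Reduces claims about tr F to scalar claims about x . A_y^{-1} x, with x running over the
  rows of \<open>B\<close>.\<close>

lemma trace_congruence:
  fixes B :: "real^'n^'l" and M :: "real^'n^'n"
  shows "trace (B ** M ** transpose B) = (\<Sum>i\<in>UNIV. B $ i \<bullet> (M *v B $ i))"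
proof -
  have "(B ** M ** transpose B) $ i $ i = B $ i \<bullet> (M *v B $ i)" for i
  proof -
    have "(B ** M ** transpose B) $ i $ i = (B ** M) $ i \<bullet> B $ i"
      by (simp add: matrix_matrix_mult_def [of "B ** M"] transpose_def inner_vec_def)
    also have "(B ** M) $ i = B $ i v* M"
      by (simp add: matrix_matrix_mult_def vector_matrix_mult_def vec_eq_iff mult.commute)
    finally show ?thesis
      by (simp add: dot_lmul_matrix)
  qed
  then show ?thesis
    by (simp add: trace_def)
qed

lemma inner_matrix_axis:
  fixes M :: "real^'n^'n"
  shows "axis i a \<bullet> (M *v axis j b) = a * b * M $ i $ j"
proof -
  have "(M *v axis j b) $ i = M $ i $ j * b"
    by (simp add: matrix_vector_mult_def axis_def if_distrib [of "\<lambda>t. _ * t"] cong: if_cong)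
  then show ?thesis
    by (simp add: inner_axis' mult_ac)
qed

lemma psd_symmetric_form:
  assumes "psd M"
  shows "x \<bullet> (M *v y) = y \<bullet> (M *v x)"
  using assms by (metis psd_def dot_matrix_vector_mul inner_commute transpose_matrix_vector dot_lmul_matrix)

text \<open>Restricting the quadratic form to the span of two coordinate axes gives a nonnegative
  binary form, whose discriminant cannot be positive.\<close>

lemma psd_entry_square_le:
  assumes "psd M"
  shows "(M $ i $ j)\<^sup>2 \<le> M $ i $ i * M $ j $ j"
proof -
  let ?a = "M $ i $ i" and ?b = "M $ i $ j" and ?d = "M $ j $ j"
  have form: "0 \<le> s * s * ?a + 2 * (s * t * ?b) + t * t * ?d" for s t
  proof -
    have "0 \<le> (axis i s + axis j t) \<bullet> (M *v (axis i s + axis j t))"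
      using assms by (auto simp: psd_def)
    moreover have "axis j t \<bullet> (M *v axis i s) = s * t * ?b"
      using psd_symmetric_form [OF assms] inner_matrix_axis by metis
    ultimately show ?thesis
      by (simp add: matrix_vector_right_distrib inner_add_left inner_add_right
          inner_matrix_axis [of i] inner_matrix_axis [of j t M j])
  qed
  have "0 \<le> ?a" "0 \<le> ?d"
    using form [of 1 0] form [of 0 1] by auto
  show ?thesis
  proof (cases "?a = 0")
    case True
    have "?b = 0"
    proof (rule ccontr)
      assume "?b \<noteq> 0"
      then show False
        \<comment> \<open>With \<open>?a\<close> zero the form is linear in s; this s is chosen so
          that the form takes the value -1.\<close>
        using form [of "- (?d + 1) / (2 * ?b)" 1] True by (simp add: field_simps)
    qed
    then show ?thesis
      using True by simp
  next
    case False
    then have "0 < ?a"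
      using \<open>0 \<le> ?a\<close> by simp
    \<comment> \<open>The arguments s = -b, t = a are, up to scaling, the minimiser in s, where the
      form equals a times the determinant.\<close>
    have "0 \<le> ?a * (?a * ?d - ?b\<^sup>2)"
      using form [of "- ?b" ?a] by (simp add: algebra_simps power2_eq_square)
    then show ?thesis
      using \<open>0 < ?a\<close> by (simp add: zero_le_mult_iff)
  qed
qed

lemma psd_trace_nonneg:
  assumes "psd M"
  shows "0 \<le> trace M"
proof -
  have "0 \<le> M $ i $ i" for i
    using assms inner_matrix_axis [of i 1 M i 1] by (metis psd_def mult_1)
  then show ?thesis
    by (simp add: trace_def sum_nonneg)
qed

lemma norm_matrix_vector_mult_le:
  fixes M :: "real^'n^'m"
  shows "norm (M *v x) \<le> norm M * norm x"
proof -
  have "norm (M *v x) = L2_set (\<lambda>i. \<bar>M $ i \<bullet> x\<bar>) UNIV"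
    by (simp add: norm_vec_def matrix_vector_mult_def inner_vec_def)
  also have "\<dots> \<le> L2_set (\<lambda>i. norm (M $ i) * norm x) UNIV"
    by (intro L2_set_mono Cauchy_Schwarz_ineq2) auto
  also have "\<dots> = norm M * norm x"
    by (simp add: norm_vec_def [of M] L2_set_left_distrib)
  finally show ?thesis .
qed

text \<open>The Frobenius norm lies between the spectral norm and the trace.\<close>

lemma psd_spectral_norm_le_trace:
  assumes "psd M"
  shows "spectral_norm M \<le> trace M"
proof -
  have "(norm M)\<^sup>2 = (\<Sum>i\<in>UNIV. \<Sum>j\<in>UNIV. (M $ i $ j)\<^sup>2)"
    unfolding power2_norm_eq_inner inner_vec_def by (simp add: power2_eq_square)
  also have "\<dots> \<le> (\<Sum>i\<in>UNIV. \<Sum>j\<in>UNIV. M $ i $ i * M $ j $ j)"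
    by (intro sum_mono psd_entry_square_le assms)
  also have "\<dots> = (trace M)\<^sup>2"
    by (simp add: trace_def power2_eq_square sum_product)
  finally have "norm M \<le> trace M"
    using psd_trace_nonneg [OF assms] power2_le_imp_le by blast
  then have "norm (M *v x) \<le> trace M * norm x" for x
    using norm_matrix_vector_mult_le [of M x] by (meson mult_right_mono norm_ge_zero order_trans)
  then show ?thesis
    unfolding spectral_norm_def by (rule onorm_le)
qed

text \<open>Frechet derivatives are unique and the inner products with a vector determine it, so the
  definite description in \<open>grad\<close> returns any gradient that is exhibited.\<close>

lemma grad_eqI:
  assumes "GDERIV f x :> D"
  shows "grad f x = D"
  unfolding grad_def
proof (rule the_equality)
  show "GDERIV f x :> D"
    by (rule assms)
  fix D'
  assume "GDERIV f x :> D'"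
  then have "(\<lambda>h. h \<bullet> D') = (\<lambda>h. h \<bullet> D)"
    using assms unfolding gderiv_def by (rule has_derivative_unique)
  then show "D' = D"
    by (metis inner_commute vector_eq_rdot)
qed

section \<open>Quadratic forms of the matrices A_y\<close>

locale psd_family =
  fixes A :: "'m::finite \<Rightarrow> real^'n^'n"
  assumes psd: "psd (A j)"
    and pd_one: "pd (mat_comb A 1)"
begin

lemma form_nonneg: "0 \<le> x \<bullet> (A j *v x)"
  using psd by (auto simp: psd_def)

lemma symmetric_form: "x \<bullet> (mat_comb A y *v z) = z \<bullet> (mat_comb A y *v x)"
  unfolding inner_mat_comb_mult by (simp add: psd_symmetric_form [OF psd])

lemma form_mono:
  assumes "\<And>j. y $ j \<le> z $ j"
  shows "x \<bullet> (mat_comb A y *v x) \<le> x \<bullet> (mat_comb A z *v x)"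
  unfolding inner_mat_comb_mult by (intro sum_mono mult_right_mono assms form_nonneg)

text \<open>c A_1 is the combination with constant coefficients c, so monotonicity applies. This is
  the bound A_y >= c A_1 behind all later estimates.\<close>

lemma form_scale:
  assumes "\<And>j. c \<le> y $ j"
  shows "c * (x \<bullet> (mat_comb A 1 *v x)) \<le> x \<bullet> (mat_comb A y *v x)"
proof -
  have "c * (x \<bullet> (mat_comb A 1 *v x)) = x \<bullet> (mat_comb A (\<chi> j. c) *v x)"
    by (simp add: inner_mat_comb_mult sum_distrib_left)
  also have "\<dots> \<le> x \<bullet> (mat_comb A y *v x)"
    by (rule form_mono) (simp add: assms)
  finally show ?thesis .
qed

lemma form_one_nonneg: "0 \<le> x \<bullet> (mat_comb A 1 *v x)"
  unfolding inner_mat_comb_mult by (simp add: sum_nonneg form_nonneg)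

text \<open>A_y >= c A_1 with A_1 positive definite forces a trivial kernel, and a square matrix
  with trivial kernel is invertible.\<close>

lemma mult_inverse:
  assumes "0 < c" "\<And>j. c \<le> y $ j"
  shows "mat_comb A y *v (matrix_inv (mat_comb A y) *v x) = x"
proof -
  have "x = 0" if "mat_comb A y *v x = 0" for x
  proof (rule ccontr)
    assume "x \<noteq> 0"
    then have "0 < c * (x \<bullet> (mat_comb A 1 *v x))"
      using pd_one assms(1) by (simp add: pd_def)
    then show False
      using form_scale [of c y x] assms(2) that by simp
  qed
  then have "invertible (mat_comb A y)"
    by (simp add: invertible_left_inverse matrix_left_invertible_ker)
  then have "mat_comb A y ** matrix_inv (mat_comb A y) = mat 1"
    unfolding matrix_inv_def invertible_def by (rule someI2_ex) simp
  then show ?thesis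
    by (simp add: matrix_vector_mul_assoc)
qed

text \<open>Polarisation of \<open>- \<epsilon> A\<^sub>1 \<preceq> A\<^sub>e \<preceq> \<epsilon> A\<^sub>1\<close>.\<close>

lemma form_polarised:
  assumes "\<And>j. \<bar>e $ j\<bar> \<le> \<epsilon>"
  shows "2 * (v \<bullet> (mat_comb A e *v u))
    \<le> \<epsilon> * (u \<bullet> (mat_comb A 1 *v u) + v \<bullet> (mat_comb A 1 *v v))"
proof -
  \<comment> \<open>Each \<open>A j\<close> is treated separately: its form at u + v and u - v
    bounds the mixed term in absolute value, which absorbs the sign of \<open>e $ j\<close>.\<close>
  have bound: "2 * (e $ j * (v \<bullet> (A j *v u))) \<le> \<epsilon> * (u \<bullet> (A j *v u) + v \<bullet> (A j *v v))" for j
  proof -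
    have "0 \<le> (u + v) \<bullet> (A j *v (u + v))" "0 \<le> (u - v) \<bullet> (A j *v (u - v))"
      by (rule form_nonneg)+
    moreover have "u \<bullet> (A j *v v) = v \<bullet> (A j *v u)"
      by (rule psd_symmetric_form [OF psd])
    ultimately have *: "\<bar>2 * (v \<bullet> (A j *v u))\<bar> \<le> u \<bullet> (A j *v u) + v \<bullet> (A j *v v)"
      by (simp add: matrix_vector_right_distrib matrix_vector_mult_diff_distrib
          inner_add_left inner_add_right inner_diff_left inner_diff_right)
    have "2 * (e $ j * (v \<bullet> (A j *v u))) \<le> \<bar>e $ j\<bar> * \<bar>2 * (v \<bullet> (A j *v u))\<bar>"
      by (metis abs_ge_self abs_mult mult.left_commute)
    also have "\<dots> \<le> \<epsilon> * (u \<bullet> (A j *v u) + v \<bullet> (A j *v v))"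
      using assms [of j] * by (intro mult_mono) auto
    finally show ?thesis .
  qed
  show ?thesis
    using sum_mono [of UNIV, OF bound]
    by (simp add: inner_mat_comb_mult sum.distrib sum_distrib_left distrib_left)
qed

section \<open>Linearisation error of the inverse and of tr F, and the gradient of tr F\<close>

lemma inverse_form_eq:
  fixes x :: "real^'n"
  assumes "0 < c" "\<And>j. c \<le> y $ j"
  defines "u \<equiv> matrix_inv (mat_comb A y) *v x"
  shows "x \<bullet> u = u \<bullet> (mat_comb A y *v u)"
  using mult_inverse [OF assms(1,2)] by (simp add: u_def inner_commute)

text \<open>The remainder equals the form of A_z at v = u - w. This gives the sign at once; the
  upper bound follows by comparing it with E through A_z v = E u and optimising a scaled
  polarisation inequality.\<close>

lemma inverse_form_remainder:
  fixes x :: "real^'n"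
  assumes c: "0 < c" and y: "\<And>j. c \<le> y $ j" and z: "\<And>j. c \<le> z $ j"
    and \<epsilon>: "\<And>j. \<bar>(z - y) $ j\<bar> \<le> \<epsilon>"
  defines "u \<equiv> matrix_inv (mat_comb A y) *v x"
    and "w \<equiv> matrix_inv (mat_comb A z) *v x"
  shows "0 \<le> x \<bullet> w - x \<bullet> u + u \<bullet> (mat_comb A (z - y) *v u)"
    and "x \<bullet> w - x \<bullet> u + u \<bullet> (mat_comb A (z - y) *v u) \<le> \<epsilon>\<^sup>2 / c\<^sup>2 * (x \<bullet> u)"
proof -
  define v where "v = u - w"
  define q where "q = v \<bullet> (mat_comb A z *v v)"
  let ?E = "mat_comb A (z - y)"
  have yu: "mat_comb A y *v u = x" and zw: "mat_comb A z *v w = x"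
    unfolding u_def w_def using mult_inverse c y z by auto
  have zv: "mat_comb A z *v v = ?E *v u"
    by (simp add: v_def matrix_vector_mult_diff_distrib zw mat_comb_diff
        matrix_vector_mult_diff_rdistrib yu)
  \<comment> \<open>Write x = A_y u = A_z u - E u. By symmetry v . A_z u = u . A_z v = u . E u, so
    the remainder is v . E u = v . A_z v.\<close>
  have "x \<bullet> v = v \<bullet> (mat_comb A z *v u) - v \<bullet> (?E *v u)"
    by (simp add: mat_comb_diff matrix_vector_mult_diff_rdistrib yu inner_diff_right inner_commute)
  also have "v \<bullet> (mat_comb A z *v u) = u \<bullet> (?E *v u)"
    using symmetric_form [of v z u] zv by simp
  finally have eq: "x \<bullet> w - x \<bullet> u + u \<bullet> (?E *v u) = q"
    by (simp add: q_def zv) (simp add: v_def inner_diff_right)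
  have vv: "c * (v \<bullet> (mat_comb A 1 *v v)) \<le> q"
    unfolding q_def using z by (rule form_scale)
  have uu: "c * (u \<bullet> (mat_comb A 1 *v u)) \<le> x \<bullet> u"
    using form_scale [OF y, of u] yu by (simp add: inner_commute)
  have q: "0 \<le> q"
    using vv form_one_nonneg [of v] c by (meson mult_nonneg_nonneg order_trans less_imp_le)
  \<comment> \<open>Index types are nonempty, so any index will do; \<open>undefined\<close> is
    one.\<close>
  have \<epsilon>0: "0 \<le> \<epsilon>"
    using \<epsilon> [of undefined] by linarith
  \<comment> \<open>Polarisation is applied to u and s v, leaving s free for optimisation. For
    nonzero \<epsilon> the choice s = c / \<epsilon> gives the bound; for \<epsilon> = 0 any
    positive s forces q = 0.\<close>
  have scaled: "2 * s * c * q \<le> \<epsilon> * (x \<bullet> u + s\<^sup>2 * q)" for s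
  proof -
    have "2 * (s * q) = 2 * ((s *\<^sub>R v) \<bullet> (?E *v u))"
      by (simp add: q_def zv)
    also have "\<dots> \<le> \<epsilon> * (u \<bullet> (mat_comb A 1 *v u) + (s *\<^sub>R v) \<bullet> (mat_comb A 1 *v (s *\<^sub>R v)))"
      using \<epsilon> by (rule form_polarised)
    also have "\<dots> = \<epsilon> * (u \<bullet> (mat_comb A 1 *v u) + s\<^sup>2 * (v \<bullet> (mat_comb A 1 *v v)))"
      by (simp add: matrix_vector_mult_scaleR power2_eq_square)
    finally have "c * (2 * (s * q))
        \<le> c * (\<epsilon> * (u \<bullet> (mat_comb A 1 *v u) + s\<^sup>2 * (v \<bullet> (mat_comb A 1 *v v))))"
      using c by simp
    also have "\<dots> = \<epsilon> * (c * (u \<bullet> (mat_comb A 1 *v u)) + s\<^sup>2 * (c * (v \<bullet> (mat_comb A 1 *v v))))"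
      by (simp add: algebra_simps)
    also have "\<dots> \<le> \<epsilon> * (x \<bullet> u + s\<^sup>2 * q)"
      using \<epsilon>0 uu vv by (intro mult_left_mono add_mono) auto
    finally show ?thesis
      by (simp add: mult_ac)
  qed
  show "0 \<le> x \<bullet> w - x \<bullet> u + u \<bullet> (?E *v u)"
    using q eq by simp
  have "q \<le> \<epsilon>\<^sup>2 / c\<^sup>2 * (x \<bullet> u)"
  proof (cases "\<epsilon> = 0")
    case True
    then show ?thesis
      using scaled [of 1] c q by (simp add: mult_le_0_iff)
  next
    case False
    then show ?thesis
      using scaled [of "c / \<epsilon>"] \<epsilon>0 c by (simp add: field_simps power2_eq_square)
  qed
  then show "x \<bullet> w - x \<bullet> u + u \<bullet> (?E *v u) \<le> \<epsilon>\<^sup>2 / c\<^sup>2 * (x \<bullet> u)"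
    using eq by simp
qed

text \<open>Entry j is -tr(B A_y^{-1} A_j A_y^{-1} B^T), expanded over the rows of \<open>B\<close>
  using the symmetry of A_y^{-1}. Being explicit, it is available before differentiability is
  known.\<close>

definition trace_grad :: "real^'n^'l \<Rightarrow> real^'m \<Rightarrow> real^'m" where
  "trace_grad B y = (\<chi> j. - (\<Sum>i\<in>UNIV. let u = matrix_inv (mat_comb A y) *v B $ i in u \<bullet> (A j *v u)))"

lemma inner_trace_grad:
  "trace_grad B y \<bullet> h = - (\<Sum>i\<in>UNIV. let u = matrix_inv (mat_comb A y) *v B $ i
    in u \<bullet> (mat_comb A h *v u))"
proof -
  have "trace_grad B y \<bullet> h = - (\<Sum>j\<in>UNIV. \<Sum>i\<in>UNIV. h $ j *
    (let u = matrix_inv (mat_comb A y) *v B $ i in u \<bullet> (A j *v u)))"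
    by (simp add: inner_vec_def trace_grad_def sum_negf sum_distrib_left mult.commute)
  then show ?thesis
    by (subst (asm) sum.swap) (simp add: inner_mat_comb_mult Let_def)
qed

lemma trace_F_map:
  "trace (F_map A B y) = (\<Sum>i\<in>UNIV. B $ i \<bullet> (matrix_inv (mat_comb A y) *v B $ i))"
  unfolding F_map_def by (rule trace_congruence)

lemma trace_F_map_nonneg:
  assumes "0 < c" "\<And>j. c \<le> y $ j"
  shows "0 \<le> trace (F_map A B y)"
  unfolding trace_F_map
proof (rule sum_nonneg)
  fix i
  let ?u = "matrix_inv (mat_comb A y) *v B $ i"
  have "0 \<le> c * (?u \<bullet> (mat_comb A 1 *v ?u))"
    using assms(1) form_one_nonneg by simp
  also have "\<dots> \<le> ?u \<bullet> (mat_comb A y *v ?u)"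
    using assms(2) by (rule form_scale)
  finally show "0 \<le> B $ i \<bullet> ?u"
    using inverse_form_eq [OF assms, of "B $ i"] by simp
qed

text \<open>Sums the scalar estimates over the rows of \<open>B\<close>. The lower bound is the
  convexity inequality; the upper one yields both differentiability and the gap estimate.\<close>

lemma trace_F_map_remainder:
  fixes B :: "real^'n^'l"
  assumes "0 < c" "\<And>j. c \<le> y $ j" "\<And>j. c \<le> z $ j" "\<And>j. \<bar>(z - y) $ j\<bar> \<le> \<epsilon>"
  defines "R \<equiv> trace (F_map A B z) - trace (F_map A B y) - trace_grad B y \<bullet> (z - y)"
  shows "0 \<le> R" and "R \<le> \<epsilon>\<^sup>2 / c\<^sup>2 * trace (F_map A B y)"
proof -
  let ?u = "\<lambda>i. matrix_inv (mat_comb A y) *v B $ i"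
  have R: "R = (\<Sum>i\<in>UNIV. B $ i \<bullet> (matrix_inv (mat_comb A z) *v B $ i) - B $ i \<bullet> ?u i
      + ?u i \<bullet> (mat_comb A (z - y) *v ?u i))"
    by (simp add: R_def trace_F_map inner_trace_grad Let_def sum.distrib sum_subtractf)
  show "0 \<le> R"
    unfolding R by (intro sum_nonneg inverse_form_remainder(1) [OF assms(1-4)])
  show "R \<le> \<epsilon>\<^sup>2 / c\<^sup>2 * trace (F_map A B y)"
    unfolding R trace_F_map sum_distrib_left
    by (intro sum_mono inverse_form_remainder(2) [OF assms(1-4)])
qed

text \<open>The linearisation error is quadratic in the increment, hence of smaller order than its
  norm.\<close>

lemma GDERIV_trace_F_map:
  assumes c: "0 < c" and y: "\<And>j. c \<le> y $ j"
  shows "GDERIV (\<lambda>y. trace (F_map A B y)) y :> trace_grad B y"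
  unfolding gderiv_def has_derivative_at_alt
proof (intro conjI allI impI)
  show "bounded_linear (\<lambda>h. h \<bullet> trace_grad B y)"
    by (rule bounded_linear_inner_left)
  fix e :: real
  assume e: "0 < e"
  define K where "K = trace (F_map A B y) / (c / 2)\<^sup>2"
  have K: "0 \<le> K"
    unfolding K_def using trace_F_map_nonneg [OF c y, of B] by simp
  \<comment> \<open>The first bound keeps the components of z above c / 2, the second makes K times
    the increment at most e; K + 1 keeps the denominator positive.\<close>
  define d where "d = min (c / 2) (e / (K + 1))"
  have "0 < d"
    using c e K by (simp add: d_def)
  moreover have "norm (trace (F_map A B z) - trace (F_map A B y) - (z - y) \<bullet> trace_grad B y)
      \<le> e * norm (z - y)" if "norm (z - y) < d" for z
  proof -
    have comp: "\<bar>(z - y) $ j\<bar> \<le> norm (z - y)" for j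
      by (rule component_le_norm_cart)
    have half: "c / 2 \<le> z $ j" "c / 2 \<le> y $ j" for j
      using comp [of j] that y [of j] c by (auto simp: d_def)
    have "K * norm (z - y) \<le> (K + 1) * (e / (K + 1))"
      using that K by (intro mult_mono) (auto simp: d_def)
    then have "K * norm (z - y) \<le> e"
      using K by simp
    then have "(norm (z - y))\<^sup>2 / (c / 2)\<^sup>2 * trace (F_map A B y) \<le> e * norm (z - y)"
      using mult_right_mono [of "K * norm (z - y)" e "norm (z - y)"]
      by (simp add: K_def power2_eq_square mult_ac)
    moreover have "0 < c / 2"
      using c by simp
    ultimately show ?thesis
      using trace_F_map_remainder [OF \<open>0 < c / 2\<close> half(2,1) comp, of B]
      by (simp add: inner_commute)
  qed
  ultimately show "\<exists>d>0. \<forall>z. norm (z - y) < d \<longrightarrow>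
      norm (trace (F_map A B z) - trace (F_map A B y) - (z - y) \<bullet> trace_grad B y)
        \<le> e * norm (z - y)"
    by blast
qed

end

section \<open>Descent, gap and contraction estimates for one linearised step\<close>

theorem theorem10:
  fixes A :: "'m::finite \<Rightarrow> real^'n^'n"
    and B :: "real^'n^'l"
    and ym yp yhat yk b :: "real^'m"
    and Yhat :: "real^'l^'l"
    and \<delta> L ymin \<gamma> \<theta> zbar :: real
    and Yadm :: "(real^'m) set"
    and r :: "real^'m \<Rightarrow> real"
  assumes A_psd: "\<And>i. psd (A i)"
    and A_nz: "\<And>i. A i \<noteq> 0"
    and A_one: "pd (mat_comb A 1)"
    and B_rank: "rank B = CARD('l)"
    and ym_pos: "\<And>i. 0 < ym $ i"
    and ym_yp: "\<And>i. ym $ i < yp $ i"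
    and \<delta>_pos: "0 < \<delta>"
    and yhat_in: "yhat \<in> {ym + \<delta> *\<^sub>R 1 .. yp - \<delta> *\<^sub>R 1}"
    and Yhat_eq: "Yhat = F_map A B yhat"
    and L_pos: "0 < L"
    and L_stab: "\<And>y z. y \<in> {ym..yp} \<Longrightarrow> z \<in> {ym..yp} \<Longrightarrow>
                   infnorm (y - z) \<le> L * spectral_norm (F_map A B y - F_map A B z)"
    and Yadm_eq: "Yadm = Y_adm A B ym yp Yhat"
    and r_eq: "r = resid A B Yhat"
    and ymin_eq: "ymin = Min (range (\<lambda>i. ym $ i))"
    and \<gamma>: "0 < \<gamma>" "\<gamma> < 1"
    and \<theta>: "0 < \<theta>" "\<theta> < 1"
    and yk_in: "yk \<in> Yadm"
    and b_eq: "b = grad (\<lambda>y. trace (F_map A B y)) yk"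
    and zbar: "(SUP w\<in>Yadm. b \<bullet> w) \<le> zbar"
  shows "(\<forall>y\<in>Yadm. r y \<le> r yk - b \<bullet> (y - yk))
       \<and> (r yk < (1 - \<gamma>) * (ymin\<^sup>2 / (L\<^sup>2 * trace Yhat)) \<longrightarrow>
            zbar - b \<bullet> yk \<ge> \<gamma> * r yk)
       \<and> (\<forall>y\<in>Yadm.
            r yk < (1 - \<gamma>) * (ymin\<^sup>2 / (L\<^sup>2 * trace Yhat)) \<and>
            b \<bullet> (y - yk) \<ge> \<theta> * (zbar - b \<bullet> yk) \<longrightarrow>
            (let \<mu> = 1 - L\<^sup>2 / ymin\<^sup>2 * r yk * trace Yhat in
               r y \<le> (1 - \<theta> * \<mu>) * r yk \<and>
               (1 - \<theta> * \<mu>) * r yk \<le> (1 - \<theta> * \<gamma>) * r yk))"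
proof -
  interpret psd_family A
    using A_psd A_one by unfold_locales
  have ymin_pos: "0 < ymin"
    unfolding ymin_eq using ym_pos by (subst Min_gr_iff) auto
  have ymin_ym: "ymin \<le> ym $ i" for i
    unfolding ymin_eq by (rule Min_le) auto
  have ymin_le: "ymin \<le> y $ i" if "y \<in> {ym..yp}" for y i
    using that order_trans [OF ymin_ym [of i]] by (auto simp: less_eq_vec_def)
  have adm: "y \<in> {ym..yp}" "psd (Yhat - F_map A B y)" if "y \<in> Yadm" for y
    using that by (auto simp: Yadm_eq Y_adm_def loewner_le_def)
  have r: "r y = trace Yhat - trace (F_map A B y)" for y
    by (simp add: r_eq resid_def trace_sub)
  have r_nonneg: "0 \<le> r y" if "y \<in> Yadm" for y
    using psd_trace_nonneg [OF adm(2) [OF that]] by (simp add: r_eq resid_def)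
  note yk = adm [OF yk_in]
  have b: "b = trace_grad B yk"
    unfolding b_eq by (rule grad_eqI [OF GDERIV_trace_F_map [OF ymin_pos ymin_le [OF yk(1)]]])
  have yhat_box: "yhat \<in> {ym..yp}"
    using yhat_in \<delta>_pos by (auto simp: less_eq_vec_def) (smt (verit))+
  have yhat_adm: "yhat \<in> Yadm"
    using yhat_box by (simp add: Yadm_eq Y_adm_def loewner_le_def psd_def Yhat_eq transpose_def
        vec_eq_iff)
  have descent: "r y \<le> r yk - b \<bullet> (y - yk)" if "y \<in> Yadm" for y
  proof -
    \<comment> \<open>Only the sign of the remainder matters here, so the crude choice of the norm
      of y - yk for \<epsilon> suffices.\<close>
    show ?thesis
      using trace_F_map_remainder(1)
        [OF ymin_pos ymin_le [OF yk(1)] ymin_le [OF adm(1) [OF that]] component_le_norm_cart, of B]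
      by (simp add: r b)
  qed
  define \<mu> where "\<mu> = 1 - L\<^sup>2 / ymin\<^sup>2 * r yk * trace Yhat"
  have gap: "\<mu> * r yk \<le> zbar - b \<bullet> yk"
  proof -
    have "\<bar>(yhat - yk) $ j\<bar> \<le> L * r yk" for j
    proof -
      have "\<bar>(yhat - yk) $ j\<bar> \<le> infnorm (yhat - yk)"
        by (rule component_le_infnorm_cart)
      also have "\<dots> \<le> L * spectral_norm (Yhat - F_map A B yk)"
        unfolding Yhat_eq by (rule L_stab [OF yhat_box yk(1)])
      also have "\<dots> \<le> L * r yk"
        using psd_spectral_norm_le_trace [OF yk(2)] L_pos by (simp add: r_eq resid_def)
      finally show ?thesis .
    qed
    \<comment> \<open>Here \<epsilon> = L r(yk) and c = \<open>ymin\<close>; since r(yhat) = 0, the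
      error is r(yk) - b . (yhat - yk).\<close>
    from trace_F_map_remainder(2) [OF ymin_pos ymin_le [OF yk(1)] ymin_le [OF yhat_box] this, of B]
    have "r yk - b \<bullet> (yhat - yk) \<le> (L * r yk)\<^sup>2 / ymin\<^sup>2 * trace (F_map A B yk)"
      by (simp add: r b Yhat_eq)
    also have "\<dots> \<le> (L * r yk)\<^sup>2 / ymin\<^sup>2 * trace Yhat"
      using r_nonneg [OF yk_in] by (intro mult_left_mono) (auto simp: r)
    finally have "\<mu> * r yk \<le> b \<bullet> (yhat - yk)"
      by (simp add: \<mu>_def algebra_simps power2_eq_square)
    \<comment> \<open>\<open>yhat\<close> is a competitor in the linearised problem; a real supremum
      dominates it only once the values are known to be bounded above, which the box
      provides.\<close>
    moreover have "b \<bullet> yhat \<le> (SUP w\<in>Yadm. b \<bullet> w)"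
    proof (rule cSUP_upper [OF yhat_adm])
      have "bounded Yadm"
        by (rule bounded_subset [OF bounded_cbox [of ym yp]])
          (auto simp: Yadm_eq Y_adm_def cbox_interval [symmetric] interval_cbox)
      then have "bounded ((\<lambda>w. b \<bullet> w) ` Yadm)"
        by (rule bounded_linear_image) (rule bounded_linear_inner_right)
      then show "bdd_above ((\<lambda>w. b \<bullet> w) ` Yadm)"
        by (rule bounded_imp_bdd_above)
    qed
    ultimately show ?thesis
      using zbar by (simp add: inner_diff_right)
  qed
  have \<mu>_ge: "\<gamma> \<le> \<mu>" if small: "r yk < (1 - \<gamma>) * (ymin\<^sup>2 / (L\<^sup>2 * trace Yhat))"
  proof -
    have "0 \<le> trace Yhat"
      unfolding Yhat_eq by (rule trace_F_map_nonneg [OF ymin_pos ymin_le [OF yhat_box]])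
    \<comment> \<open>Division by zero yields 0, so a zero trace would turn the smallness condition
      into r(yk) < 0.\<close>
    moreover have "trace Yhat \<noteq> 0"
      using small r_nonneg [OF yk_in] by auto
    ultimately show ?thesis
      using small ymin_pos L_pos by (simp add: \<mu>_def field_simps)
  qed
  have \<mu>_r: "\<gamma> * r yk \<le> \<mu> * r yk" if "r yk < (1 - \<gamma>) * (ymin\<^sup>2 / (L\<^sup>2 * trace Yhat))"
    using \<mu>_ge [OF that] r_nonneg [OF yk_in] by (rule mult_right_mono)
  \<comment> \<open>\<open>descent\<close> leaves at most r(yk) - \<theta> (zbar - b . yk), and
    \<open>gap\<close> multiplied by \<theta> bounds the subtracted term below.\<close>
  have "r y \<le> (1 - \<theta> * \<mu>) * r yk"
    if "y \<in> Yadm" "\<theta> * (zbar - b \<bullet> yk) \<le> b \<bullet> (y - yk)" for y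
    using descent [OF that(1)] that(2) mult_left_mono [OF gap, of \<theta>] \<theta>
    by (simp add: algebra_simps)
  moreover have "(1 - \<theta> * \<mu>) * r yk \<le> (1 - \<theta> * \<gamma>) * r yk"
    if "r yk < (1 - \<gamma>) * (ymin\<^sup>2 / (L\<^sup>2 * trace Yhat))"
    using mult_left_mono [OF \<mu>_r [OF that], of \<theta>] \<theta> by (simp add: algebra_simps)
  ultimately show ?thesis
    using descent gap \<mu>_r unfolding Let_def \<mu>_def [symmetric] by fastforce
qed

end
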